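(* Let $(V,V^+)$ be an ordered real vector space with an order unit $e$. Let $D := \{ v \in V : re + v \in V^+ \text{ for all real } r >0 \}$ and $N := D \cap -D$, and consider the quotient vector space $V/N$ with $$(V/N)^+ := \{ v + N : v \in D \}.$$ Then $(V/N, (V/N)^+)$ is an ordered real vector space and $e+N$ is an Archimedean order unit for this space.
   Context: An ordered real vector space $(V,V^+)$ is a real vector space $V$ with a nonempty subset $V^+\subseteq V$ closed under addition and under multiplication by scalars in $[0,\infty)$, such that $V^+\cap -V^+=\{0\}$. One writes $v\ge w$ if $v-w\in V^+$. An element $e\in V$ is an order unit if for each $v\in V$ there is a real $r>0$ with $re\ge v$; it is an Archimedean order unit if, in addition, whenever $v\in V$ satisfies $re+v\ge 0$ for all real $r>0$, then $v\in V^+$. The set $N$ is a real subspace of $V$. *)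

theory Defs
  imports "HOL-Algebra.Algebraic_Closure_Type"
begin

abbreviation real_ring :: "real ring"
  where "real_ring \<equiv> ring_of_type_algebra"

text \<open>
  A real vector space is a module over \<^term>\<open>real_ring\<close>. Carriers are explicit, so that
  the same notions apply to a space and to its quotients. The fields \<^const>\<open>monoid.mult\<close> and
  \<^const>\<open>monoid.one\<close> that the record of a module inherits from rings are irrelevant here.
\<close>

locale ordered_real_vector_space = module real_ring V
  for V :: "(real, 'a, 'm) module_scheme" (structure) and P :: "'a set" +
  assumes cone_subset: "P \<subseteq> carrier V"
    and cone_nonempty: "P \<noteq> {}"
    and cone_add: "\<lbrakk>v \<in> P; w \<in> P\<rbrakk> \<Longrightarrow> v \<oplus> w \<in> P"
    and cone_smult: "\<lbrakk>(r::real) \<ge> 0; v \<in> P\<rbrakk> \<Longrightarrow> r \<odot> v \<in> P"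
    and cone_inter_minus: "P \<inter> a_inv V ` P = {\<zero>}"

definition cone_ge :: "('s, 'a, 'm) module_scheme \<Rightarrow> 'a set \<Rightarrow> 'a \<Rightarrow> 'a \<Rightarrow> bool"
  where "cone_ge V P v w \<longleftrightarrow> v \<ominus>\<^bsub>V\<^esub> w \<in> P"

definition order_unit :: "(real, 'a, 'm) module_scheme \<Rightarrow> 'a set \<Rightarrow> 'a \<Rightarrow> bool"
  where "order_unit V P e \<longleftrightarrow>
    e \<in> carrier V \<and> (\<forall>v\<in>carrier V. \<exists>r>0. cone_ge V P (r \<odot>\<^bsub>V\<^esub> e) v)"

definition archimedean_order_unit :: "(real, 'a, 'm) module_scheme \<Rightarrow> 'a set \<Rightarrow> 'a \<Rightarrow> bool"
  where "archimedean_order_unit V P e \<longleftrightarrow>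
    order_unit V P e \<and>
    (\<forall>v\<in>carrier V. (\<forall>r>0. cone_ge V P (r \<odot>\<^bsub>V\<^esub> e \<oplus>\<^bsub>V\<^esub> v) \<zero>\<^bsub>V\<^esub>) \<longrightarrow> v \<in> P)"

text \<open>
  The carrier, zero and addition (and the irrelevant multiplication and one) are those of
  \<^const>\<open>FactRing\<close>. Scalar multiplication is stated without a choice of representatives, in the
  style of \<^const>\<open>rcoset_mult\<close>; a plain elementwise product would give \<open>{\<zero>}\<close> instead of
  \<open>N\<close> for the scalar 0.
\<close>

definition quotient_module ::
    "('s, 'a, 'm) module_scheme \<Rightarrow> 'a set \<Rightarrow> ('s, 'a set) module"
  where "quotient_module V N =
    \<lparr>carrier = a_rcosets\<^bsub>V\<^esub> N, monoid.mult = rcoset_mult V N, one = N +>\<^bsub>V\<^esub> \<one>\<^bsub>V\<^esub>,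
     zero = N, add = set_add V,
     module.smult = (\<lambda>r A. \<Union>x\<in>A. N +>\<^bsub>V\<^esub> (r \<odot>\<^bsub>V\<^esub> x))\<rparr>"

lemma (in module) quotient_module_add_coset:
  assumes "submodule N R M" "v \<in> carrier M" "w \<in> carrier M"
  shows "(N +>\<^bsub>M\<^esub> v) \<oplus>\<^bsub>quotient_module M N\<^esub> (N +>\<^bsub>M\<^esub> w) = N +>\<^bsub>M\<^esub> (v \<oplus>\<^bsub>M\<^esub> w)"
proof -
  interpret N: abelian_subgroup N M
    using submodule.axioms(1)[OF assms(1)] module.axioms(2)[OF module_axioms]
    by (intro abelian_subgroupI3 additive_subgroup.intro)
  show ?thesis
    using N.a_rcos_sum assms(2,3) by (simp add: quotient_module_def)
qed

lemma (in module) quotient_module_smult_coset: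
  assumes N: "submodule N R M" and r: "r \<in> carrier R" and v: "v \<in> carrier M"
  shows "r \<odot>\<^bsub>quotient_module M N\<^esub> (N +>\<^bsub>M\<^esub> v) = N +>\<^bsub>M\<^esub> (r \<odot>\<^bsub>M\<^esub> v)"
proof -
  interpret N: abelian_subgroup N M
    using submodule.axioms(1)[OF assms(1)] module.axioms(2)[OF module_axioms]
    by (intro abelian_subgroupI3 additive_subgroup.intro)
  have "N +>\<^bsub>M\<^esub> (r \<odot>\<^bsub>M\<^esub> x) = N +>\<^bsub>M\<^esub> (r \<odot>\<^bsub>M\<^esub> v)" if x: "x \<in> N +>\<^bsub>M\<^esub> v" for x
  proof -
    from x obtain n where n: "n \<in> N" "x = n \<oplus>\<^bsub>M\<^esub> v"
      by (auto simp: a_r_coset_def')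
    have nM: "n \<in> carrier M" using n(1) N.a_subset by blast
    have "r \<odot>\<^bsub>M\<^esub> x = (r \<odot>\<^bsub>M\<^esub> n) \<oplus>\<^bsub>M\<^esub> (r \<odot>\<^bsub>M\<^esub> v)"
      using n(2) nM r v by (simp add: smult_r_distr)
    moreover have "r \<odot>\<^bsub>M\<^esub> n \<in> N"
      using submodule.smult_closed[OF N r n(1)] .
    ultimately have "r \<odot>\<^bsub>M\<^esub> x \<in> N +>\<^bsub>M\<^esub> (r \<odot>\<^bsub>M\<^esub> v)"
      by (auto simp: a_r_coset_def')
    then show ?thesis
      using N.a_repr_independence'[OF _ smult_closed[OF r v]] by simp
  qed
  moreover have "v \<in> N +>\<^bsub>M\<^esub> v" using N.a_rcos_self[OF v] .
  ultimately have "(\<Union>x\<in>N +>\<^bsub>M\<^esub> v. N +>\<^bsub>M\<^esub> (r \<odot>\<^bsub>M\<^esub> x)) = N +>\<^bsub>M\<^esub> (r \<odot>\<^bsub>M\<^esub> v)"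
    by blast
  then show ?thesis
    by (simp add: quotient_module_def)
qed

end

theory Submission
  imports Defs
begin

text \<open>
  The closure \<open>D\<close> of the cone \<open>P\<close> along the order unit \<open>e\<close> is again a convex cone: it
  absorbs sums because \<open>r e + (v + w) = (r/2 e + v) + (r/2 e + w)\<close>, and it contains \<open>P\<close>
  because \<open>e\<close> itself lies in \<open>P\<close>. What \<open>D\<close> may lack is properness, and \<open>N = D \<inter> -D\<close> is
  precisely the largest subspace contained in a convex cone \<open>D\<close>. Passing to the quotient by
  this subspace therefore yields a proper cone (\<open>quotient_ordered_real_vector_space\<close>), and
  since \<open>D + N \<subseteq> D\<close>, a coset \<open>v + N\<close> belongs to the quotient cone if and only if \<open>v \<in> D\<close>
  (\<open>coset_in_quotient_cone_iff\<close>). By that equivalence the two order unit conditions on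
  \<open>e + N\<close> become statements about representatives: \<open>r e - v \<in> D\<close> for some \<open>r\<close>, which holds
  as \<open>P \<subseteq> D\<close>; and \<open>v \<in> D\<close> whenever \<open>r e + v \<in> D\<close> for all \<open>r > 0\<close>, which follows by splitting
  \<open>r e = r/2 e + r/2 e\<close>.
\<close>

section \<open>Quotient modules\<close>

context module
begin

lemma abelian_subgroup_submodule:
  assumes "submodule N R M"
  shows "abelian_subgroup N M"
  using submodule.axioms(1)[OF assms] abelian_group_axioms
  by (intro abelian_subgroupI3 additive_subgroup.intro)

lemma a_inv_zero: "\<ominus>\<^bsub>M\<^esub> \<zero>\<^bsub>M\<^esub> = \<zero>\<^bsub>M\<^esub>"
  by (rule M.minus_equality) simp_all

lemma carrier_quotient_module:
  "carrier (quotient_module M N) = {N +>\<^bsub>M\<^esub> v | v. v \<in> carrier M}"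
  by (auto simp: quotient_module_def A_RCOSETS_def')

lemma zero_quotient_module [simp]: "\<zero>\<^bsub>quotient_module M N\<^esub> = N"
  by (simp add: quotient_module_def)

lemma coset_zero:
  assumes "submodule N R M"
  shows "N +>\<^bsub>M\<^esub> \<zero>\<^bsub>M\<^esub> = N"
proof -
  interpret N: abelian_subgroup N M using abelian_subgroup_submodule[OF assms] .
  show ?thesis by (simp add: N.a_subset)
qed

lemma module_quotient_module:
  assumes N: "submodule N R M"
  shows "module R (quotient_module M N)"
proof -
  let ?Q = "quotient_module M N"
  note [simp] = quotient_module_add_coset[OF N] quotient_module_smult_coset[OF N]
  have in_Q: "N +>\<^bsub>M\<^esub> v \<in> carrier ?Q" if "v \<in> carrier M" for v
    using that by (auto simp: carrier_quotient_module)
  have QE: thesis if "A \<in> carrier ?Q" "\<And>v. v \<in> carrier M \<Longrightarrow> A = N +>\<^bsub>M\<^esub> v \<Longrightarrow> thesis" for A thesis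
    using that by (auto simp: carrier_quotient_module)
  have N0: "\<zero>\<^bsub>?Q\<^esub> = N +>\<^bsub>M\<^esub> \<zero>\<^bsub>M\<^esub>"
    by (simp add: coset_zero[OF N])
  have "abelian_group ?Q"
  proof (rule abelian_groupI)
    show "\<exists>B\<in>carrier ?Q. B \<oplus>\<^bsub>?Q\<^esub> A = \<zero>\<^bsub>?Q\<^esub>" if "A \<in> carrier ?Q" for A
      using that
    proof (rule QE)
      fix v assume v: "v \<in> carrier M" "A = N +>\<^bsub>M\<^esub> v"
      then have "(N +>\<^bsub>M\<^esub> (\<ominus>\<^bsub>M\<^esub> v)) \<oplus>\<^bsub>?Q\<^esub> A = \<zero>\<^bsub>?Q\<^esub>"
        by (simp add: N0 M.l_neg del: zero_quotient_module)
      then show ?thesis using in_Q[of "\<ominus>\<^bsub>M\<^esub> v"] v by blast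
    qed
  qed (auto elim!: QE intro!: in_Q simp: N0 M.a_ac simp del: zero_quotient_module)
  then show ?thesis
    by (intro module.intro is_cring module_axioms.intro)
      (auto elim!: QE intro!: in_Q simp: smult_l_distr smult_r_distr smult_assoc1)
qed

lemma a_inv_quotient_module_coset:
  assumes N: "submodule N R M" and v: "v \<in> carrier M"
  shows "\<ominus>\<^bsub>quotient_module M N\<^esub> (N +>\<^bsub>M\<^esub> v) = N +>\<^bsub>M\<^esub> (\<ominus>\<^bsub>M\<^esub> v)"
proof -
  interpret Q: module R "quotient_module M N" using module_quotient_module[OF N] .
  show ?thesis
    using v by (intro Q.minus_equality)
      (auto simp: quotient_module_add_coset[OF N] M.l_neg coset_zero[OF N] carrier_quotient_module)
qed

lemma quotient_module_minus_coset:
  assumes N: "submodule N R M" and "v \<in> carrier M" "w \<in> carrier M"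
  shows "(N +>\<^bsub>M\<^esub> v) \<ominus>\<^bsub>quotient_module M N\<^esub> (N +>\<^bsub>M\<^esub> w) = N +>\<^bsub>M\<^esub> (v \<ominus>\<^bsub>M\<^esub> w)"
  using assms by (simp add: a_minus_def a_inv_quotient_module_coset quotient_module_add_coset)

lemma coset_eqE:
  assumes N: "submodule N R M" and v: "v \<in> carrier M" "w \<in> carrier M"
    and eq: "N +>\<^bsub>M\<^esub> v = N +>\<^bsub>M\<^esub> w"
  obtains n where "n \<in> N" "v = n \<oplus>\<^bsub>M\<^esub> w"
proof -
  interpret N: abelian_subgroup N M using abelian_subgroup_submodule[OF N] .
  from N.a_rcos_self[OF v(1)] show thesis
    unfolding eq using that by (auto simp: a_r_coset_def')
qed

end

section \<open>Modules over the field of reals\<close>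

lemma real_ring_simps [simp]:
  "carrier real_ring = UNIV"
  "r \<otimes>\<^bsub>real_ring\<^esub> s = r * s" "\<one>\<^bsub>real_ring\<^esub> = 1"
  "r \<oplus>\<^bsub>real_ring\<^esub> s = r + s" "\<zero>\<^bsub>real_ring\<^esub> = 0"
  by (simp_all add: ring_of_type_algebra_def)

lemma a_inv_real_ring [simp]: "\<ominus>\<^bsub>real_ring\<^esub> r = - r"
proof -
  interpret cring real_ring by (rule cring_from_type_algebra)
  show ?thesis by (intro minus_equality) simp_all
qed

text \<open>
  Real vector spaces in the encoding by modules. The laws below restate the module axioms with
  the arithmetic of the type \<^typ>\<open>real\<close> in place of the operations of \<^const>\<open>real_ring\<close>.
\<close>

locale real_module = module real_ring V
  for V :: "(real, 'a, 'm) module_scheme" (structure)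
begin

lemma real_smult_closed [simp]: "v \<in> carrier V \<Longrightarrow> r \<odot> v \<in> carrier V"
  using smult_closed[of r v] by simp

lemma real_smult_zero [simp]: "v \<in> carrier V \<Longrightarrow> 0 \<odot> v = \<zero>"
  using smult_l_null[of v] by simp

lemma real_smult_one [simp]: "v \<in> carrier V \<Longrightarrow> 1 \<odot> v = v"
  using smult_one[of v] by simp

lemma real_smult_add_left: "v \<in> carrier V \<Longrightarrow> (r + s) \<odot> v = r \<odot> v \<oplus> s \<odot> v"
  using smult_l_distr[of r s v] by simp

lemma real_smult_assoc: "v \<in> carrier V \<Longrightarrow> (r * s) \<odot> v = r \<odot> (s \<odot> v)"
  using smult_assoc1[of r s v] by simp

lemma real_smult_minus_left: "v \<in> carrier V \<Longrightarrow> (- r) \<odot> v = \<ominus> (r \<odot> v)"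
  using smult_l_minus[of r v] by simp

lemma smult_half_add: "v \<in> carrier V \<Longrightarrow> (r / 2) \<odot> v \<oplus> (r / 2) \<odot> v = r \<odot> v"
  using real_smult_add_left[of v "r / 2" "r / 2"] by simp

end

sublocale ordered_real_vector_space \<subseteq> real_module V
  by unfold_locales

section \<open>Convex cones and their lineality spaces\<close>

text \<open>
  A convex cone that need not be proper: the intersection with its negative may be larger
  than zero.
\<close>

locale convex_cone = real_module V
  for V :: "(real, 'a, 'm) module_scheme" (structure) and D :: "'a set" +
  assumes cone_carrier: "D \<subseteq> carrier V"
    and zero_in_cone: "\<zero> \<in> D"
    and cone_add_closed: "\<lbrakk>v \<in> D; w \<in> D\<rbrakk> \<Longrightarrow> v \<oplus> w \<in> D"
    and cone_smult_closed: "\<lbrakk>(r::real) \<ge> 0; v \<in> D\<rbrakk> \<Longrightarrow> r \<odot> v \<in> D"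
begin

text \<open>The lineality space, that is, the largest subspace contained in the cone.\<close>

definition lineality :: "'a set"
  where "lineality = D \<inter> a_inv V ` D"

lemma lineality_iff: "v \<in> lineality \<longleftrightarrow> v \<in> D \<and> \<ominus> v \<in> D"
  using cone_carrier by (force simp: lineality_def image_iff)

lemma submodule_lineality: "submodule lineality real_ring V"
proof (rule submoduleI)
  show "lineality \<subseteq> carrier V" "\<zero> \<in> lineality"
    using cone_carrier zero_in_cone by (auto simp: lineality_iff a_inv_zero)
next
  fix v assume v: "v \<in> lineality"
  then have vc: "v \<in> carrier V" using cone_carrier by (auto simp: lineality_iff)
  show neg: "\<ominus> v \<in> lineality" using v vc by (simp add: lineality_iff)
  fix w assume w: "w \<in> lineality"
  then have "w \<in> carrier V" using cone_carrier by (auto simp: lineality_iff)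
  then show "v \<oplus> w \<in> lineality"
    using v w vc by (simp add: lineality_iff cone_add_closed M.minus_add)
next
  fix r :: real and v
  assume v: "v \<in> lineality"
  then have vc: "v \<in> carrier V" using cone_carrier by (auto simp: lineality_iff)
  show "r \<odot> v \<in> lineality"
  proof (cases "r \<ge> 0")
    case True
    then show ?thesis
      using v vc cone_smult_closed[of r v] cone_smult_closed[of r "\<ominus> v"]
      by (simp add: lineality_iff smult_r_minus)
  next
    case False
    (* A negative scalar exchanges the two memberships that define the lineality space. *)
    have "r \<odot> v = (-r) \<odot> (\<ominus> v)" "\<ominus> (r \<odot> v) = (-r) \<odot> v"
      using vc by (simp_all add: real_smult_minus_left smult_r_minus)
    then show ?thesis
      using False v cone_smult_closed[of "-r" v] cone_smult_closed[of "-r" "\<ominus> v"]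
      by (simp add: lineality_iff)
  qed
qed

lemmas quotient_simps = quotient_module_add_coset[OF submodule_lineality]
  quotient_module_smult_coset[OF submodule_lineality]
  a_inv_quotient_module_coset[OF submodule_lineality]
  quotient_module_minus_coset[OF submodule_lineality]

abbreviation Q :: "(real, 'a set) module"
  where "Q \<equiv> quotient_module V lineality"

text \<open>The image of the cone under the projection onto the quotient by its lineality space.\<close>

definition quotient_cone :: "'a set set"
  where "quotient_cone = {lineality +> v | v. v \<in> D}"

text \<open>
  Although \<^const>\<open>quotient_cone\<close> only asks for some representative in the cone, every
  representative then lies in it, because the lineality space is itself part of the cone.
\<close>

lemma coset_in_quotient_cone_iff:
  assumes v: "v \<in> carrier V"
  shows "lineality +> v \<in> quotient_cone \<longleftrightarrow> v \<in> D"
proof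
  assume "lineality +> v \<in> quotient_cone"
  then obtain w where w: "w \<in> D" "lineality +> v = lineality +> w"
    by (auto simp: quotient_cone_def)
  then obtain n where "n \<in> lineality" "v = n \<oplus> w"
    using coset_eqE[OF submodule_lineality v] cone_carrier by blast
  then show "v \<in> D" using w cone_add_closed by (simp add: lineality_iff)
qed (auto simp: quotient_cone_def)

lemma quotient_ordered_real_vector_space: "ordered_real_vector_space Q quotient_cone"
proof -
  interpret Q: module real_ring Q using module_quotient_module[OF submodule_lineality] .
  interpret L: abelian_subgroup lineality V
    using abelian_subgroup_submodule[OF submodule_lineality] .
  have coneE: thesis
    if "A \<in> quotient_cone" "\<And>v. v \<in> D \<Longrightarrow> v \<in> carrier V \<Longrightarrow> A = lineality +> v \<Longrightarrow> thesis" for A thesis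
    using that cone_carrier by (auto simp: quotient_cone_def)
  have zero: "\<zero>\<^bsub>Q\<^esub> \<in> quotient_cone"
    using coset_in_quotient_cone_iff[of \<zero>] zero_in_cone coset_zero[OF submodule_lineality] by simp
  show ?thesis
  proof (intro ordered_real_vector_space.intro ordered_real_vector_space_axioms.intro Q.module_axioms)
    show "quotient_cone \<subseteq> carrier Q"
      by (auto elim!: coneE simp: carrier_quotient_module)
    show "quotient_cone \<noteq> {}" using zero by auto
    show "A \<oplus>\<^bsub>Q\<^esub> B \<in> quotient_cone" if "A \<in> quotient_cone" "B \<in> quotient_cone" for A B
      using that by (auto elim!: coneE simp: quotient_simps coset_in_quotient_cone_iff cone_add_closed)
    show "r \<odot>\<^bsub>Q\<^esub> A \<in> quotient_cone" if "r \<ge> 0" "A \<in> quotient_cone" for r :: real and A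
      using that by (auto elim!: coneE simp: quotient_simps coset_in_quotient_cone_iff cone_smult_closed)
    show "quotient_cone \<inter> a_inv Q ` quotient_cone = {\<zero>\<^bsub>Q\<^esub>}"
    proof (intro equalityI subsetI)
      fix A assume "A \<in> quotient_cone \<inter> a_inv Q ` quotient_cone"
      then obtain v w where v: "v \<in> D" "v \<in> carrier V" "A = lineality +> v"
        and w: "w \<in> D" "w \<in> carrier V" "A = \<ominus>\<^bsub>Q\<^esub> (lineality +> w)"
        by (auto elim!: coneE)
      (* The cosets of v and of -v both lie in the quotient cone, so v and -v both lie in D. *)
      then have "lineality +> (\<ominus> v) = lineality +> w"
        using Q.minus_minus[of "lineality +> w"] quotient_simps(3)[of v]
        by (auto simp: carrier_quotient_module)
      then have "lineality +> (\<ominus> v) \<in> quotient_cone"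
        using w by (simp add: coset_in_quotient_cone_iff)
      then have "v \<in> lineality"
        using v by (simp add: coset_in_quotient_cone_iff lineality_iff)
      then show "A \<in> {\<zero>\<^bsub>Q\<^esub>}"
        using v L.a_rcos_const by simp
    next
      fix A assume "A \<in> {\<zero>\<^bsub>Q\<^esub>}"
      moreover have "\<zero>\<^bsub>Q\<^esub> \<in> a_inv Q ` quotient_cone"
        by (rule image_eqI[OF _ zero]) (simp add: Q.a_inv_zero del: zero_quotient_module)
      ultimately show "A \<in> quotient_cone \<inter> a_inv Q ` quotient_cone"
        using zero by blast
    qed
  qed
qed

text \<open>
  The second assumption already says that \<open>D\<close> is closed in the direction of \<open>e\<close>; this, rather
  than the passage to the quotient, is what makes the order unit Archimedean.
\<close>

lemma quotient_archimedean_order_unit: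
  assumes e: "order_unit V D e"
    and arch: "\<And>v. \<lbrakk>v \<in> carrier V; \<forall>r>0. r \<odot> e \<oplus> v \<in> D\<rbrakk> \<Longrightarrow> v \<in> D"
  shows "archimedean_order_unit Q quotient_cone (lineality +> e)"
proof -
  interpret Q: module real_ring Q using module_quotient_module[OF submodule_lineality] .
  have ec: "e \<in> carrier V" using e by (simp add: order_unit_def)
  have ge: "cone_ge Q quotient_cone (r \<odot>\<^bsub>Q\<^esub> (lineality +> e)) (lineality +> v) \<longleftrightarrow> cone_ge V D (r \<odot> e) v"
    if "v \<in> carrier V" for r v
    using that ec by (simp add: cone_ge_def quotient_simps coset_in_quotient_cone_iff)
  have ge0: "cone_ge Q quotient_cone (r \<odot>\<^bsub>Q\<^esub> (lineality +> e) \<oplus>\<^bsub>Q\<^esub> (lineality +> v)) \<zero>\<^bsub>Q\<^esub>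
      \<longleftrightarrow> r \<odot> e \<oplus> v \<in> D" if "v \<in> carrier V" for r v
  proof -
    have "\<zero>\<^bsub>Q\<^esub> = lineality +> \<zero>" by (simp add: coset_zero[OF submodule_lineality])
    then show ?thesis
      using that ec
      by (simp add: cone_ge_def quotient_simps coset_in_quotient_cone_iff M.minus_eq a_inv_zero del: zero_quotient_module)
  qed
  have "order_unit Q quotient_cone (lineality +> e)"
    unfolding order_unit_def
  proof (intro conjI ballI)
    show "lineality +> e \<in> carrier Q" using ec by (auto simp: carrier_quotient_module)
    fix A assume "A \<in> carrier Q"
    then obtain v where v: "v \<in> carrier V" "A = lineality +> v"
      by (auto simp: carrier_quotient_module)
    then show "\<exists>r>0. cone_ge Q quotient_cone (r \<odot>\<^bsub>Q\<^esub> (lineality +> e)) A"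
      using e unfolding v(2) ge[OF v(1)] by (simp add: order_unit_def)
  qed
  moreover have "A \<in> quotient_cone" if A: "A \<in> carrier Q"
    and pos: "\<forall>r>0. cone_ge Q quotient_cone (r \<odot>\<^bsub>Q\<^esub> (lineality +> e) \<oplus>\<^bsub>Q\<^esub> A) \<zero>\<^bsub>Q\<^esub>" for A
  proof -
    obtain v where v: "v \<in> carrier V" "A = lineality +> v"
      using A by (auto simp: carrier_quotient_module)
    have "\<forall>r>0. r \<odot> e \<oplus> v \<in> D" using pos unfolding v(2) ge0[OF v(1)] .
    then show ?thesis using v arch by (simp add: coset_in_quotient_cone_iff)
  qed
  ultimately show ?thesis unfolding archimedean_order_unit_def by blast
qed

end

section \<open>Closing a cone along an order unit\<close>

text \<open>
  The vectors that become members of \<open>P\<close> after adding an arbitrarily small positive multiple of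
  \<open>e\<close>.
\<close>

definition unit_closure :: "(real, 'a, 'm) module_scheme \<Rightarrow> 'a set \<Rightarrow> 'a \<Rightarrow> 'a set"
  where "unit_closure V P e = {v \<in> carrier V. \<forall>r>0. r \<odot>\<^bsub>V\<^esub> e \<oplus>\<^bsub>V\<^esub> v \<in> P}"

context ordered_real_vector_space
begin

lemma zero_in_positive_cone: "\<zero> \<in> P"
  using cone_inter_minus by blast

text \<open>Some positive multiple of an order unit dominates zero, hence so does the unit itself.\<close>

lemma order_unit_in_cone:
  assumes "order_unit V P e"
  shows "e \<in> P"
proof -
  have ec: "e \<in> carrier V" using assms by (simp add: order_unit_def)
  obtain r :: real where r: "r > 0" "r \<odot> e \<ominus> \<zero> \<in> P"
    using assms M.zero_closed unfolding order_unit_def cone_ge_def by blast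
  have "(1 / r) \<odot> (r \<odot> e) \<in> P"
    using r ec by (intro cone_smult[of _ "r \<odot> e"]) (auto simp: M.minus_eq a_inv_zero)
  moreover have "(1 / r) \<odot> (r \<odot> e) = e"
    using r(1) ec real_smult_assoc[of e "1 / r" r] by simp
  ultimately show ?thesis by simp
qed

lemma cone_subset_unit_closure:
  assumes "e \<in> P"
  shows "P \<subseteq> unit_closure V P e"
  using cone_subset cone_add[OF cone_smult[OF less_imp_le assms]] by (auto simp: unit_closure_def)

lemma convex_cone_unit_closure:
  assumes e: "e \<in> P"
  shows "convex_cone V (unit_closure V P e)"
proof (intro convex_cone.intro convex_cone_axioms.intro real_module_axioms)
  have ec: "e \<in> carrier V" using e cone_subset by blast
  show "unit_closure V P e \<subseteq> carrier V" by (auto simp: unit_closure_def)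
  show zero: "\<zero> \<in> unit_closure V P e"
    using zero_in_positive_cone cone_subset_unit_closure[OF e] by blast
  show "v \<oplus> w \<in> unit_closure V P e"
    if v: "v \<in> unit_closure V P e" and w: "w \<in> unit_closure V P e" for v w
  proof -
    have "r \<odot> e \<oplus> (v \<oplus> w) \<in> P" if "r > 0" for r :: real
    proof -
      have "((r / 2) \<odot> e \<oplus> v) \<oplus> ((r / 2) \<odot> e \<oplus> w) \<in> P"
        using v w that by (auto simp: unit_closure_def intro: cone_add[of "_ \<odot> e \<oplus> _" "_ \<odot> e \<oplus> _"])
      also have "((r / 2) \<odot> e \<oplus> v) \<oplus> ((r / 2) \<odot> e \<oplus> w)
          = ((r / 2) \<odot> e \<oplus> (r / 2) \<odot> e) \<oplus> (v \<oplus> w)"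
        using ec v w by (simp add: unit_closure_def M.a_ac)
      finally show ?thesis using ec by (simp add: smult_half_add)
    qed
    then show ?thesis using v w by (simp add: unit_closure_def)
  qed
  show "s \<odot> v \<in> unit_closure V P e" if s: "s \<ge> 0" and v: "v \<in> unit_closure V P e" for s :: real and v
  proof (cases "s = 0")
    case True
    then show ?thesis using zero v by (simp add: unit_closure_def)
  next
    case False
    have vc: "v \<in> carrier V" using v by (simp add: unit_closure_def)
    have "r \<odot> e \<oplus> s \<odot> v \<in> P" if "r > 0" for r :: real
    proof -
      have "s \<odot> ((r / s) \<odot> e \<oplus> v) \<in> P"
        using v that s False by (intro cone_smult) (auto simp: unit_closure_def)
      also have "s \<odot> ((r / s) \<odot> e \<oplus> v) = r \<odot> e \<oplus> s \<odot> v"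
        using ec vc False real_smult_assoc[of e s "r / s"] by (simp add: smult_r_distr)
      finally show ?thesis .
    qed
    then show ?thesis using vc by (simp add: unit_closure_def)
  qed
qed

text \<open>Closing a second time along \<open>e\<close> adds no vectors.\<close>

lemma unit_closure_closed:
  assumes ec: "e \<in> carrier V" and v: "v \<in> carrier V"
    and ge: "\<forall>r>0. r \<odot> e \<oplus> v \<in> unit_closure V P e"
  shows "v \<in> unit_closure V P e"
proof -
  have "r \<odot> e \<oplus> v \<in> P" if "r > 0" for r :: real
  proof -
    have "(r / 2) \<odot> e \<oplus> ((r / 2) \<odot> e \<oplus> v) \<in> P"
      using ge that by (simp add: unit_closure_def)
    also have "(r / 2) \<odot> e \<oplus> ((r / 2) \<odot> e \<oplus> v) = r \<odot> e \<oplus> v"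
      using ec v by (simp add: smult_half_add flip: M.a_assoc)
    finally show ?thesis .
  qed
  then show ?thesis using v by (simp add: unit_closure_def)
qed

end

theorem theorem2p35:
  fixes V :: "(real, 'a, 'm) module_scheme" and P D N :: "'a set" and e :: 'a
  assumes V: "ordered_real_vector_space V P"
    and e: "order_unit V P e"
    and D: "D = {v \<in> carrier V. \<forall>r>0. r \<odot>\<^bsub>V\<^esub> e \<oplus>\<^bsub>V\<^esub> v \<in> P}"
    and N: "N = D \<inter> a_inv V ` D"
  shows "ordered_real_vector_space (quotient_module V N) {N +>\<^bsub>V\<^esub> v | v. v \<in> D} \<and>
    archimedean_order_unit (quotient_module V N) {N +>\<^bsub>V\<^esub> v | v. v \<in> D} (N +>\<^bsub>V\<^esub> e)"
proof -
  interpret ordered_real_vector_space V P using V .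
  have eP: "e \<in> P" and ec: "e \<in> carrier V"
    using order_unit_in_cone[OF e] cone_subset by auto
  have D_eq: "D = unit_closure V P e" by (simp add: D unit_closure_def)
  interpret D: convex_cone V D
    unfolding D_eq using convex_cone_unit_closure[OF eP] .
  have "order_unit V D e"
    using e cone_subset_unit_closure[OF eP] unfolding order_unit_def cone_ge_def D_eq by blast
  then have "archimedean_order_unit D.Q D.quotient_cone (D.lineality +>\<^bsub>V\<^esub> e)"
    using unit_closure_closed[OF ec]
    by (intro D.quotient_archimedean_order_unit) (simp_all add: D_eq)
  with D.quotient_ordered_real_vector_space show ?thesis
    by (simp add: N D.lineality_def D.quotient_cone_def)
qed

end
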